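(* Let $\mathsf{F}$ be a field, let $r\ge 2$ be an integer, and let $f\in\mathsf{F}[x]$ be nonzero of degree $n$, where the characteristic of $\mathsf{F}$ is either zero or greater than $n$. If $f$ is a perfect $r$th power in $\mathsf{F}[x]$, then the algorithm ComputeRootNewton on input $(f,r)$ returns an $h\in\mathsf{F}[x]$ such that $h^r=f$.
   Context: $f$ is a perfect $r$th power if $f=h^r$ for some $h\in\mathsf{F}[x]$. Algorithm ComputeRootNewton, on input $f\in\mathsf{F}[x]$ and $r$ such that $f$ is a perfect $r$th power, is: 1. Let $u$ be the largest integer with $x^u\mid f$, let $f_u$ be the coefficient of $x^u$ in $f$, and set $g\leftarrow f/(f_ux^u)$. 2. Set $h\leftarrow 1$, $k\leftarrow 1$. 3. While $kr\le\deg g$: set $\ell\leftarrow\min\{k,\ (\deg g)/r+1-k\}$; set $a\leftarrow \dfrac{(hg-h^{r+1})\operatorname{rem}x^{k+\ell}}{r x^k}$; set $h\leftarrow h+(a/g\bmod x^\ell)\cdot x^k$; set $k\leftarrow k+\ell$. 4. Let $b$ be any $r$th root of $f_u$ in $\mathsf{F}$. Return $b\,h\,x^{u/r}$. Here $\operatorname{rem}x^{m}$ denotes the remainder on division by $x^m$, and $a/g\bmod x^\ell$ is the polynomial of degree less than $\ell$ congruent to $a g^{-1}$ modulo $x^\ell$ ($g$ has constant coefficient $1$). *)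

theory Defs
  imports "HOL-Computational_Algebra.Computational_Algebra" "HOL-Library.Monad_Syntax"
begin

text \<open>The quotients in the algorithm (of polynomials and of natural numbers) are meant to be exact.
  They are taken in the option monad, so that a returned value certifies that all divisions
  performed along the way were exact and had a nonzero divisor.\<close>

definition exact_div :: "'a::semidom_divide \<Rightarrow> 'a \<Rightarrow> 'a option" where
  "exact_div a b = (if b \<noteq> 0 \<and> b dvd a then Some (a div b) else None)"

text \<open>\<open>a/g mod x^l\<close>. The algorithm only uses this for \<open>g\<close> with constant coefficient 1, which is
  invertible modulo \<open>x^l\<close>; being congruent to \<open>a g^{-1}\<close> is then the same as \<open>g c\<close> being
  congruent to \<open>a\<close>, and \<open>c\<close> exists and is unique. The disjunct \<open>c = 0\<close> reflects that the zero
  polynomial has degree \<open>-\<infinity>\<close>, whereas \<open>degree 0 = 0\<close> in the library.\<close>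

definition quotient_mod_x_power :: "'a::field poly \<Rightarrow> 'a poly \<Rightarrow> nat \<Rightarrow> 'a poly" where
  "quotient_mod_x_power a g l =
     (THE c. (c = 0 \<or> degree c < l) \<and> (g * c) mod monom 1 l = a mod monom 1 l)"

text \<open>The while loop, started in state \<open>(h, k)\<close>; the least fixed point is \<^term>\<open>None\<close> also
  when the loop does not terminate. The truncated subtraction in \<open>l\<close> is harmless, because
  \<open>k * r \<le> degree g\<close> at that point.\<close>

partial_function (option) newton_loop ::
    "nat \<Rightarrow> 'a::field poly \<Rightarrow> 'a poly \<Rightarrow> nat \<Rightarrow> 'a poly option" where
  "newton_loop r g h k =
     (if k * r \<le> degree g then do {
        d \<leftarrow> exact_div (degree g) r;
        let l = min k (d + 1 - k);
        a \<leftarrow> exact_div ((h * g - h ^ (r + 1)) mod monom 1 (k + l)) (monom (of_nat r) k);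
        newton_loop r g (h + quotient_mod_x_power a g l * monom 1 k) (k + l)
      }
      else Some h)"

text \<open>The set of all values that the algorithm may return on input \<open>(f, r)\<close>, one for each choice of
  the root \<open>b\<close>. All other steps are deterministic, so the set is empty if one of them is
  undefined, if the loop diverges, or if there is no suitable \<open>b\<close>.\<close>

definition compute_root_newton :: "'a::field poly \<Rightarrow> nat \<Rightarrow> 'a poly set" where
  "compute_root_newton f r =
     (let u = (GREATEST u. monom 1 u dvd f); fu = coeff f u in
      {y. \<exists>g h v b.
         exact_div f (monom fu u) = Some g \<and>
         newton_loop r g 1 1 = Some h \<and>
         b ^ r = fu \<and>
         exact_div u r = Some v \<and>
         y = smult b (h * monom 1 v)})"

end

theory Submission imports Defs begin

text \<open>Write \<open>f = fu x^u s^r\<close> with \<open>s(0) = 1\<close>, so that \<open>g = s^r\<close>. The loop maintains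
  \<open>h = s mod x^k\<close>: with \<open>s = h + e x^k\<close>, expanding \<open>(h + e x^k)^r\<close> to first order gives
  \<open>h g - h^(r+1) = r h^r e x^k = r g e x^k\<close> modulo \<open>x^(2k)\<close>, so that \<open>a = g e mod x^l\<close> and
  the correction \<open>a/g mod x^l\<close> is \<open>e mod x^l\<close>. On exit \<open>k > deg s\<close>, hence \<open>h = s\<close>. The
  characteristic only enters through \<open>r \<noteq> 0\<close>, which is needed when the loop body is executed;
  then \<open>r \<le> deg f\<close>.\<close>

lemma exact_div_mult_left:
  fixes b c :: "'a::semidom_divide"
  shows "b \<noteq> 0 \<Longrightarrow> exact_div (b * c) b = Some c"
  by (simp add: exact_div_def)

text \<open>Passing from \<open>r\<close> to \<open>Suc r\<close> multiplies the old error by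
  \<open>h + y\<close> and adds \<open>y\<^sup>2 * (of_nat r * h ^ r)\<close>. The extra factor
  \<open>h\<close> keeps the exponent \<open>r - 1\<close> out of the linear term.\<close>

lemma square_dvd_power_add_first_order:
  fixes h y :: "'a::comm_ring_1"
  shows "y\<^sup>2 dvd h * (h + y) ^ r - h ^ (r + 1) - of_nat r * h ^ r * y"
proof (induction r)
  case (Suc r)
  have "h * (h + y) ^ Suc r - h ^ (Suc r + 1) - of_nat (Suc r) * h ^ Suc r * y =
      (h + y) * (h * (h + y) ^ r - h ^ (r + 1) - of_nat r * h ^ r * y) + y\<^sup>2 * (of_nat r * h ^ r)"
    by (simp add: algebra_simps power2_eq_square)
  with Suc.IH show ?case
    by simp
qed simp

lemma monom_1_mult_monom_1: "monom 1 i * monom 1 j = (monom 1 (i + j) :: 'a::comm_semiring_1 poly)"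
  by (simp add: mult_monom)

lemma degree_mod_monom_1_less:
  fixes p :: "'a::field poly"
  shows "p mod monom 1 l = 0 \<or> degree (p mod monom 1 l) < l"
  using degree_mod_less[of "monom 1 l" p] by (simp add: degree_monom_eq)

lemma mod_monom_1_eq_self:
  fixes p :: "'a::field poly"
  shows "p = 0 \<or> degree p < l \<Longrightarrow> p mod monom 1 l = p"
  by (auto simp: mod_poly_less degree_monom_eq)

text \<open>The next \<open>l\<close> coefficients of \<open>s\<close> are appended to its first
  \<open>k\<close>; this identifies the updated \<open>h\<close> in the loop as a longer truncation
  of \<open>s\<close>.\<close>

lemma mod_monom_1_add:
  fixes s :: "'a::field poly"
  shows "s mod monom 1 k + (s div monom 1 k mod monom 1 l) * monom 1 k = s mod monom 1 (k + l)"
    (is "?h + ?c * ?X = _")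
proof -
  have "s = ?X * (s div ?X) + ?h"
    by simp
  then have "s mod monom 1 (k + l) = (?X * (s div ?X)) mod (?X * monom 1 l) + ?h mod monom 1 (k + l)"
    by (metis poly_mod_add_left monom_1_mult_monom_1)
  also have "?h mod monom 1 (k + l) = ?h"
    by (rule mod_monom_1_eq_self) (use degree_mod_monom_1_less[of s k] in auto)
  also have "(?X * (s div ?X)) mod (?X * monom 1 l) = ?X * ?c"
    by (rule mod_mult_mult1)
  finally show ?thesis
    by (simp add: mult.commute add.commute)
qed

text \<open>The order at 0 is additive on products, and \<open>g\<close> contributes nothing to
  it.\<close>

lemma monom_1_dvd_mult_cancel:
  fixes g p :: "'a::field poly"
  assumes "coeff g 0 \<noteq> 0" "monom 1 l dvd g * p"
  shows "monom 1 l dvd p"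
proof (cases "p = 0")
  case False
  have "g \<noteq> 0" "order 0 g = 0"
    using assms(1) by (auto simp: poly_0_coeff_0 intro: order_0I)
  moreover have "[:- 0, 1:] ^ l dvd g * p"
    using assms(2) by (simp add: monom_altdef)
  ultimately have "[:- 0, 1:] ^ l dvd p"
    using False by (simp add: order_divides[where a = 0, simplified] order_mult)
  then show ?thesis
    by (simp add: monom_altdef)
qed simp

text \<open>Since \<open>g\<close> cancels modulo x^l, any candidate \<open>c\<close> agrees with
  \<open>e\<close> modulo x^l, and the degree bound makes \<open>c\<close> its own
  remainder.\<close>

lemma quotient_mod_x_power_mult:
  fixes g e :: "'a::field poly"
  assumes "coeff g 0 \<noteq> 0"
  shows "quotient_mod_x_power ((g * e) mod monom 1 l) g l = e mod monom 1 l"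
  unfolding quotient_mod_x_power_def
proof (rule the_equality, goal_cases)
  case 1
  then show ?case
    using degree_mod_monom_1_less[of e l] by (simp add: mod_mult_right_eq)
next
  case (2 c)
  then have "(g * c) mod monom 1 l = (g * e) mod monom 1 l"
    by simp
  then have "monom 1 l dvd g * (c - e)"
    by (simp add: mod_eq_dvd_iff algebra_simps)
  then have "monom 1 l dvd c - e"
    by (rule monom_1_dvd_mult_cancel[OF assms])
  then have "c mod monom 1 l = e mod monom 1 l"
    by (simp add: mod_eq_dvd_iff)
  with 2 show ?case
    by (simp add: mod_monom_1_eq_self)
qed

text \<open>The bound \<open>l \<le> k\<close> lets all multiples of x^(2k) vanish modulo x^(k+l).
  Pulling out \<open>monom (of_nat r) k\<close> shows that the division in the loop is exact and
  what its quotient is.\<close>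

lemma newton_residue:
  fixes s :: "'a::field poly"
  assumes "l \<le> k"
  defines "h \<equiv> s mod monom 1 k" and "e \<equiv> s div monom 1 k"
  shows "(h * s ^ r - h ^ (r + 1)) mod monom 1 (k + l) =
           monom (of_nat r) k * ((s ^ r * e) mod monom 1 l)"
proof -
  let ?X = "monom 1 k :: 'a poly"
  have s: "s = h + e * ?X"
    unfolding h_def e_def by (simp only: mod_mult_div_eq mod_div_mult_eq)
  have X2: "monom 1 (k + l) dvd ?X * ?X"
    using assms(1) by (simp add: monom_1_mult_monom_1 monom_1_dvd_iff')
  have "(e * ?X)\<^sup>2 dvd h * s ^ r - h ^ (r + 1) - of_nat r * h ^ r * (e * ?X)"
    using square_dvd_power_add_first_order[of "e * ?X" h r] s by simp
  moreover have "?X * ?X dvd (e * ?X)\<^sup>2"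
    by (simp add: power2_eq_square mult.assoc mult.left_commute)
  ultimately have 1: "monom 1 (k + l) dvd h * s ^ r - h ^ (r + 1) - of_nat r * h ^ r * (e * ?X)"
    using X2 dvd_trans by blast
  \<comment> \<open>The linear term already carries a factor x^k, so replacing \<open>h ^ r\<close>
    by \<open>s ^ r\<close> in it costs only a multiple of x^(2k).\<close>
  have "?X dvd h ^ r - s ^ r"
  proof -
    have "(h ^ r) mod ?X = (s ^ r) mod ?X"
      by (simp add: h_def power_mod)
    then show ?thesis
      by (simp add: mod_eq_dvd_iff)
  qed
  then have "?X * ?X dvd (h ^ r - s ^ r) * ?X"
    by (rule mult_dvd_mono) simp
  then have "monom 1 (k + l) dvd (h ^ r - s ^ r) * ?X * (of_nat r * e)"
    using X2 dvd_trans dvd_mult2 by blast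
  with 1 have "monom 1 (k + l) dvd
      (h * s ^ r - h ^ (r + 1) - of_nat r * h ^ r * (e * ?X)) + (h ^ r - s ^ r) * ?X * (of_nat r * e)"
    by (rule dvd_add)
  then have "monom 1 (k + l) dvd h * s ^ r - h ^ (r + 1) - ?X * (of_nat r * (s ^ r * e))"
    by (simp add: algebra_simps)
  then have "(h * s ^ r - h ^ (r + 1)) mod monom 1 (k + l) =
      (?X * (of_nat r * (s ^ r * e))) mod monom 1 (k + l)"
    by (simp only: mod_eq_dvd_iff)
  also have "\<dots> = ?X * ((of_nat r * (s ^ r * e)) mod monom 1 l)"
    by (simp only: mod_mult_mult1 flip: monom_1_mult_monom_1)
  also have "\<dots> = monom (of_nat r) k * ((s ^ r * e) mod monom 1 l)"
    by (simp add: of_nat_poly mod_smult_left) (simp add: smult_monom flip: mult_smult_left)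
  finally show ?thesis .
qed

text \<open>Induction on the number of coefficients of \<open>s\<close> still to be found. The cap
  on the step length preserves \<open>k \<le> degree s + 1\<close>, and each step has positive
  length.\<close>

lemma newton_loop_power:
  fixes s :: "'a::field poly"
  assumes "coeff s 0 = 1" "r > 0" "degree s = 0 \<or> of_nat r \<noteq> (0 :: 'a)"
    and "1 \<le> k" "k \<le> degree s + 1"
  shows "newton_loop r (s ^ r) (s mod monom 1 k) k = Some s"
  using assms(4,5)
proof (induction "degree s + 1 - k" arbitrary: k rule: less_induct)
  case less
  have "s \<noteq> 0"
    using assms(1) by auto
  have deg: "degree (s ^ r) = r * degree s"
    by (simp add: degree_power_eq \<open>s \<noteq> 0\<close>)
  have g0: "coeff (s ^ r) 0 \<noteq> 0"
    using assms(1) by (simp add: coeff_0_power)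
  show ?case
  proof (cases "k \<le> degree s")
    \<comment> \<open>Here \<open>k = degree s + 1\<close>: the loop exits and the truncation is all
      of \<open>s\<close>.\<close>
    case False
    then show ?thesis
      using \<open>r > 0\<close> by (subst newton_loop.simps) (simp add: deg mod_monom_1_eq_self mult.commute)
  next
    case True
    define l where "l = min k (degree s + 1 - k)"
    have l: "l \<le> k" "0 < l" "k + l \<le> degree s + 1"
      using True less.prems by (auto simp: l_def)
    have r0: "monom (of_nat r) k \<noteq> (0 :: 'a poly)"
      using assms(3) True less.prems by auto
    have d: "exact_div (degree (s ^ r)) r = Some (degree s)"
      unfolding deg using \<open>r > 0\<close> by (intro exact_div_mult_left) simp
    have a: "exact_div ((s mod monom 1 k * s ^ r - (s mod monom 1 k) ^ (r + 1)) mod monom 1 (k + l))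
        (monom (of_nat r) k) = Some ((s ^ r * (s div monom 1 k)) mod monom 1 l)"
      unfolding newton_residue[OF l(1)] using r0 by (rule exact_div_mult_left)
    have "k * r \<le> degree (s ^ r)"
      using True by (simp add: deg)
    then have "newton_loop r (s ^ r) (s mod monom 1 k) k =
        newton_loop r (s ^ r) (s mod monom 1 (k + l)) (k + l)"
      by (subst newton_loop.simps)
        (simp only: if_True d a Let_def bind.bind_lunit quotient_mod_x_power_mult[OF g0]
          mod_monom_1_add flip: l_def)
    also have "\<dots> = Some s"
      using l less.prems True by (intro less.hyps) auto
    finally show ?thesis .
  qed
qed

text \<open>Take \<open>v\<close> to be the order of \<open>p\<close> at 0 and \<open>c\<close> the
  lowest nonzero coefficient, which is then divided out.\<close>

lemma decompose_monom_monic_at_0: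
  fixes p :: "'a::field poly"
  assumes "p \<noteq> 0"
  obtains c v s where "c \<noteq> 0" "coeff s 0 = 1" "p = monom c v * s"
proof -
  obtain q where q: "p = [:- 0, 1:] ^ order 0 p * q" "\<not> [:- 0, 1:] dvd q"
    using order_decomp[OF assms] by blast
  define c where "c = coeff q 0"
  have "c \<noteq> 0"
    using q(2) by (simp add: c_def dvd_iff_poly_eq_0 poly_0_coeff_0)
  moreover have "p = monom c (order 0 p) * smult (inverse c) q"
    using q(1) \<open>c \<noteq> 0\<close> by (simp add: monom_altdef)
  ultimately show ?thesis
    using that[of c "smult (inverse c) q" "order 0 p"] by (simp add: c_def)
qed

theorem theorem3p2:
  fixes f :: "'a::field poly" and r n :: nat
  assumes "r \<ge> 2"
    and "f \<noteq> 0"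
    and "degree f = n"
    and "CHAR('a) = 0 \<or> CHAR('a) > n"
    and "is_nth_power r f"
  shows "compute_root_newton f r \<noteq> {} \<and> (\<forall>h \<in> compute_root_newton f r. h ^ r = f)"
proof -
  obtain p where p: "f = p ^ r"
    using assms(5) by (auto simp: is_nth_power_def)
  then have "p \<noteq> 0"
    using assms(1,2) by auto
  then obtain c v s where cvs: "c \<noteq> 0" "coeff s 0 = 1" "p = monom c v * s"
    by (rule decompose_monom_monic_at_0)
  have "s \<noteq> 0"
    using cvs(2) by auto
  have f: "f = monom (c ^ r) (v * r) * s ^ r"
    by (simp add: p cvs(3) power_mult_distrib monom_power)
  have coeff_f: "coeff f (v * r) = c ^ r"
    by (simp add: f coeff_monom_mult coeff_0_power cvs(2))
  have u: "(GREATEST u. monom 1 u dvd f) = v * r"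
  proof (rule Greatest_equality)
    show "monom 1 (v * r) dvd f"
      unfolding f monom_1_dvd_iff' by (simp add: coeff_monom_mult)
    show "u \<le> v * r" if "monom 1 u dvd f" for u
    proof (rule ccontr)
      assume "\<not> u \<le> v * r"
      with that have "coeff f (v * r) = 0"
        unfolding monom_1_dvd_iff' by simp
      with coeff_f cvs(1) show False
        by simp
    qed
  qed
  have g: "exact_div f (monom (c ^ r) (v * r)) = Some (s ^ r)"
    unfolding f by (rule exact_div_mult_left) (simp add: cvs(1))
  \<comment> \<open>If \<open>s\<close> is not constant, then 0 < r \<le> n, so a positive
    characteristic above \<open>n\<close> cannot divide \<open>r\<close>.\<close>
  have "degree s = 0 \<or> of_nat r \<noteq> (0 :: 'a)"
  proof (cases "degree s = 0")
    case False
    have "r \<le> degree s * r"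
      using False by simp
    also have "\<dots> \<le> n"
      using \<open>s \<noteq> 0\<close> cvs(1) assms(3)
      by (simp add: f degree_mult_eq degree_monom_eq degree_power_eq mult.commute)
    finally show ?thesis
      using assms(1,4) by (auto simp: of_nat_eq_0_iff_char_dvd dest: dvd_imp_le)
  qed simp
  then have "newton_loop r (s ^ r) (s mod monom 1 1) 1 = Some s"
    using assms(1) cvs(2) by (intro newton_loop_power) auto
  \<comment> \<open>The initial value 1 of \<open>h\<close> is the truncation of \<open>s\<close> at
    \<open>k = 1\<close>.\<close>
  moreover have "s mod monom 1 1 = 1"
  proof -
    have "monom 1 1 dvd s - 1"
      using cvs(2) by (simp add: monom_1_dvd_iff')
    then have "s mod monom 1 1 = 1 mod monom 1 1"
      by (simp only: mod_eq_dvd_iff)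
    then show ?thesis
      by (simp add: mod_monom_1_eq_self)
  qed
  ultimately have loop: "newton_loop r (s ^ r) 1 1 = Some s"
    by simp
  have "exact_div (v * r) r = Some v"
    using assms(1) exact_div_mult_left[of r v] by (simp add: mult.commute)
  then have "compute_root_newton f r = {smult b (s * monom 1 v) | b. b ^ r = c ^ r}"
    using loop by (auto simp: compute_root_newton_def Let_def u coeff_f g)
  \<comment> \<open>Only \<open>b ^ r\<close> enters the power, so every choice of root works;
    \<open>b = c\<close> shows that one exists.\<close>
  moreover have "smult b (s * monom 1 v) ^ r = f" if "b ^ r = c ^ r" for b
  proof -
    have "smult b (s * monom 1 v) = monom b v * s"
      by (metis mult.commute mult_smult_right mult.right_neutral smult_monom)
    then show ?thesis
      by (simp add: f power_mult_distrib monom_power that)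
  qed
  ultimately show ?thesis
    by auto
qed

end
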